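(* Let $A\in\mathbb{R}^{n\times n}$, $C\in\mathbb{R}^{m\times n}$ and let $\alpha>0$. If $A$ is Schur stable and $(A,C)$ is observable, then the discrete-time system $$X_{k+1}=A^\top X_kA+\alpha\,\mathrm{tr}(X_k)\,C^\top C$$ on $\mathbb{S}_+^n$ is ultimately strictly positive: there exists $T>0$ such that $X_k\succ 0$ for all $k\ge T$ and all initial states $X_1\in\mathbb{S}_+^n\setminus\{0\}$.
   Context: $\mathbb{S}_+^n$ is the cone of real symmetric positive semidefinite $n\times n$ matrices; $X\succ0$ means $X$ is positive definite. $A$ is Schur stable if all its eigenvalues lie in the open unit disk. The pair $(A,C)$ is observable if the stacked matrix $\mathrm{col}(C,CA,\dots,CA^{n-1})$ has full (column) rank $n$. The sequence is indexed by integers $k\ge 1$, with initial state $X_1$. *)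

theory Defs
  imports
    Complex_Main
    "Jordan_Normal_Form.Char_Poly"
    "Jordan_Normal_Form.DL_Rank"
begin

definition mat_trace :: "real mat \<Rightarrow> real" where
  "mat_trace X = (\<Sum>i<dim_row X. X $$ (i, i))"

definition psd_cone :: "nat \<Rightarrow> real mat set" where
  "psd_cone n = {X \<in> carrier_mat n n. transpose_mat X = X \<and>
     (\<forall>v \<in> carrier_vec n. 0 \<le> v \<bullet> (X *\<^sub>v v))}"

definition pos_definite :: "nat \<Rightarrow> real mat \<Rightarrow> bool" where
  "pos_definite n X \<longleftrightarrow> X \<in> carrier_mat n n \<and> transpose_mat X = X \<and>
     (\<forall>v \<in> carrier_vec n. v \<noteq> 0\<^sub>v n \<longrightarrow> 0 < v \<bullet> (X *\<^sub>v v))"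

(* The eigenvalues of a real matrix are its complex ones, hence the complexification. *)
definition schur_stable :: "real mat \<Rightarrow> bool" where
  "schur_stable A \<longleftrightarrow>
     (\<forall>\<mu>. eigenvalue (map_mat complex_of_real A) \<mu> \<longrightarrow> cmod \<mu> < 1)"

(* col(C, C A, ..., C A^(n-1)) for C with m rows and A of size n x n:
   row k * m + l is row l of C A^k (for k < n and l < m). *)
definition observability_mat :: "real mat \<Rightarrow> real mat \<Rightarrow> real mat" where
  "observability_mat A C = (let n = dim_row A; m = dim_row C in
     mat (n * m) n (\<lambda>(i, j). (C * (A ^\<^sub>m (i div m))) $$ (i mod m, j)))"

(* The first argument of vec_space.rank is the number of rows of the matrix. *)
definition observable :: "real mat \<Rightarrow> real mat \<Rightarrow> bool" where
  "observable A C \<longleftrightarrow>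
     vec_space.rank (dim_row A * dim_row C) (observability_mat A C) = dim_row A"

end

theory Submission
  imports Defs
begin

text \<open>
  The trace of a nonzero positive semidefinite matrix is positive, and by observability
  \<open>C \<noteq> 0\<close>; hence \<open>X k\<close> never becomes zero and each step contributes a positive
  multiple of \<open>C\<^sup>T C\<close>. If the quadratic form of \<open>X (1 + j)\<close> vanishes at \<open>v\<close>, then
  \<open>C A\<^sup>i v = 0\<close> for all \<open>i < j\<close>; for \<open>j \<ge> n\<close> observability forces \<open>v = 0\<close>. So \<open>T = n + 1\<close> works.
\<close>

text \<open>The diagonal entries are values of the quadratic form at unit vectors, so a zero trace
  makes all of them vanish. Semidefiniteness then forces the off-diagonal entries to vanish as
  well.\<close>

lemma psd_cone_trace_pos:
  assumes X: "X \<in> psd_cone n" and nz: "X \<noteq> 0\<^sub>m n n"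
  shows "0 < mat_trace X"
proof -
  have Xc: "X \<in> carrier_mat n n" and sym: "transpose_mat X = X"
    and nn: "\<And>v. v \<in> carrier_vec n \<Longrightarrow> 0 \<le> v \<bullet> (X *\<^sub>v v)"
    using X by (auto simp: psd_cone_def)
  have entry: "unit_vec n i \<bullet> (X *\<^sub>v unit_vec n j) = X $$ (i, j)" if "i < n" "j < n" for i j
    using that Xc by (simp add: scalar_prod_left_unit)
  have diag: "0 \<le> X $$ (i, i)" if "i < n" for i
    using nn[of "unit_vec n i"] entry that by simp
  have ge0: "0 \<le> mat_trace X"
    unfolding mat_trace_def using Xc diag by (auto intro!: sum_nonneg)
  moreover have "mat_trace X \<noteq> 0"
  proof
    assume "mat_trace X = 0"
    then have d0: "X $$ (i, i) = 0" if "i < n" for i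
      using sum_nonneg_eq_0_iff[of "{..<n}" "\<lambda>i. X $$ (i, i)"] that diag Xc
      by (auto simp: mat_trace_def)
    have "X $$ (i, j) = 0" if ij: "i < n" "j < n" for i j
    proof -
      have symij: "X $$ (j, i) = X $$ (i, j)"
        using ij Xc arg_cong[OF sym, of "\<lambda>M. M $$ (i, j)"] by simp
      let ?e = "unit_vec n i" and ?f = "unit_vec n j"
      \<comment> \<open>With a zero diagonal only the cross terms survive, so the form is linear in
        \<open>t\<close>. Being nonnegative at both \<open>t = 1\<close> and \<open>t = -1\<close>,
        it must have slope zero.\<close>
      have "(?e + t \<cdot>\<^sub>v ?f) \<bullet> (X *\<^sub>v (?e + t \<cdot>\<^sub>v ?f)) = 2 * t * X $$ (i, j)" for t :: real
      proof -
        have "X *\<^sub>v (?e + t \<cdot>\<^sub>v ?f) = X *\<^sub>v ?e + t \<cdot>\<^sub>v (X *\<^sub>v ?f)"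
          using Xc by (simp add: mult_add_distrib_mat_vec[OF Xc] mult_mat_vec[OF Xc])
        moreover have "X *\<^sub>v ?e \<in> carrier_vec n" "X *\<^sub>v ?f \<in> carrier_vec n"
          using Xc by auto
        ultimately show ?thesis
          using ij Xc
          by (simp add: add_scalar_prod_distrib[of _ n] scalar_prod_add_distrib[of _ n]
              entry d0 symij del: scalar_prod_left_unit scalar_prod_right_unit)
      qed
      then have "0 \<le> 2 * t * X $$ (i, j)" for t
        using nn[of "?e + t \<cdot>\<^sub>v ?f"] by simp
      from this[of 1] this[of "-1"] show ?thesis by simp
    qed
    then have "X = 0\<^sub>m n n" using Xc by (intro eq_matI) auto
    with nz show False by simp
  qed
  ultimately show ?thesis by simp
qed

text \<open>A maximal independent subset of the set of columns has \<open>rank A = nc\<close>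
  elements, so the list of \<open>nc\<close> columns cannot repeat any. This is needed because
  \<open>lin_depI\<close> and \<open>full_rank_lin_indpt\<close> speak of the set of
  columns.\<close>

lemma (in vec_space) full_rank_distinct_cols:
  assumes A: "A \<in> carrier_mat n nc" and rk: "rank A = nc"
  shows "distinct (cols A)"
proof -
  have "lin_indpt {}" by (simp add: lin_dep_def)
  then obtain S where S: "maximal S (\<lambda>T. T \<subseteq> set (cols A) \<and> lin_indpt T)"
    using maximal_exists_superset[of "set (cols A)" "\<lambda>T. T \<subseteq> set (cols A) \<and> lin_indpt T" "{}"]
    by auto
  then have "card S \<le> card (set (cols A))" by (simp add: card_mono maximal_def)
  then have "length (cols A) \<le> card (set (cols A))"
    using rank_card_indpt[OF A S] rk A by simp
  then show ?thesis
    using card_length[of "cols A"] by (simp add: card_distinct)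
qed

text \<open>A nonzero such \<open>v\<close> would be the coefficient vector of a linear dependency
  among the columns of the observability matrix, against full column rank.\<close>

lemma observable_injective:
  assumes A: "A \<in> carrier_mat n n" and C: "C \<in> carrier_mat m n" and obs: "observable A C"
    and v: "v \<in> carrier_vec n"
    and ker: "\<And>i. i < n \<Longrightarrow> C *\<^sub>v (A ^\<^sub>m i *\<^sub>v v) = 0\<^sub>v m"
  shows "v = 0\<^sub>v n"
proof (rule ccontr)
  assume nz: "v \<noteq> 0\<^sub>v n"
  let ?O = "observability_mat A C"
  have O: "?O \<in> carrier_mat (n * m) n"
    using A C by (simp add: observability_mat_def)
  have rk: "vec_space.rank (n * m) ?O = n"
    using obs A C by (simp add: observable_def)
  have "?O *\<^sub>v v = 0\<^sub>v (n * m)"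
  proof (rule eq_vecI)
    fix r assume "r < dim_vec (0\<^sub>v (n * m) :: real vec)"
    then have r: "r < n * m" by simp
    \<comment> \<open>The existence of a row index \<open>r\<close> excludes \<open>m = 0\<close>,
      where \<open>r mod m\<close> would not be a row index of \<open>C\<close>.\<close>
    then have m: "0 < m" by (cases m) auto
    have k: "r div m < n" and l: "r mod m < m"
      using r m by (auto simp: less_mult_imp_div_less)
    have Ak: "A ^\<^sub>m (r div m) \<in> carrier_mat n n" using A by simp
    have "row ?O r = row (C * A ^\<^sub>m (r div m)) (r mod m)"
      using r l carrier_matD[OF A] carrier_matD[OF C] carrier_matD[OF Ak] carrier_matD[OF O]
      by (intro eq_vecI) (simp_all add: observability_mat_def del: pow_mat_dim)
    then have "(?O *\<^sub>v v) $ r = ((C * A ^\<^sub>m (r div m)) *\<^sub>v v) $ (r mod m)"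
      using r l C O by simp
    also have "\<dots> = 0"
      using ker[OF k] l assoc_mult_mat_vec[OF C Ak v] by simp
    finally show "(?O *\<^sub>v v) $ r = 0\<^sub>v (n * m) $ r" using r by simp
  qed (use O in simp)
  moreover have dist: "distinct (cols ?O)"
    using vec_space.full_rank_distinct_cols[OF O rk] .
  ultimately show False
    using vec_space.lin_depI[OF O v nz] vec_space.full_rank_lin_indpt[OF O rk] dist by blast
qed

text \<open>Each transpose moves across the scalar product (\<open>adj\<close>). The result splits
  the form into two terms of visible sign, which serves both \<open>psd_cone_step\<close> and
  \<open>quadratic_form_step_eq_0\<close>.\<close>

lemma quadratic_form_step:
  fixes A C X :: "real mat"
  assumes A: "A \<in> carrier_mat n n" and C: "C \<in> carrier_mat m n" and X: "X \<in> carrier_mat n n"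
    and v: "v \<in> carrier_vec n"
  shows "v \<bullet> ((transpose_mat A * X * A + c \<cdot>\<^sub>m (transpose_mat C * C)) *\<^sub>v v)
    = (A *\<^sub>v v) \<bullet> (X *\<^sub>v (A *\<^sub>v v)) + c * ((C *\<^sub>v v) \<bullet> (C *\<^sub>v v))"
proof -
  have adj: "v \<bullet> (transpose_mat M *\<^sub>v w) = (M *\<^sub>v v) \<bullet> w"
    if "M \<in> carrier_mat r n" "w \<in> carrier_vec r" for M :: "real mat" and r w
    using transpose_vec_mult_scalar[OF that(1) v that(2)] that v
    by (metis comm_scalar_prod mult_mat_vec_carrier transpose_carrier_mat)
  have Av: "A *\<^sub>v v \<in> carrier_vec n" and Cv: "C *\<^sub>v v \<in> carrier_vec m"
    using A C v by auto
  have smult: "(c \<cdot>\<^sub>m M) *\<^sub>v v = c \<cdot>\<^sub>v (M *\<^sub>v v)" if "M \<in> carrier_mat n n" for M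
    using that v by (intro eq_vecI) auto
  have "(transpose_mat A * X * A) *\<^sub>v v = transpose_mat A *\<^sub>v (X *\<^sub>v (A *\<^sub>v v))"
    using A X v by (simp add: assoc_mult_mat_vec[of _ n n _ n] del: assoc_mult_mat)
  moreover have "(c \<cdot>\<^sub>m (transpose_mat C * C)) *\<^sub>v v = c \<cdot>\<^sub>v (transpose_mat C *\<^sub>v (C *\<^sub>v v))"
    using C v by (simp add: smult assoc_mult_mat_vec[of _ n m])
  ultimately have "(transpose_mat A * X * A + c \<cdot>\<^sub>m (transpose_mat C * C)) *\<^sub>v v
      = transpose_mat A *\<^sub>v (X *\<^sub>v (A *\<^sub>v v)) + c \<cdot>\<^sub>v (transpose_mat C *\<^sub>v (C *\<^sub>v v))"
    using A C X v by (subst add_mult_distrib_mat_vec[of _ n n]) auto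
  then show ?thesis
    using A C X v Av Cv adj[OF A, of "X *\<^sub>v (A *\<^sub>v v)"] adj[OF C Cv]
    by (simp add: scalar_prod_add_distrib[of _ n])
qed

lemma scalar_prod_self_nonneg: "0 \<le> (w :: real vec) \<bullet> w"
  by (auto simp: scalar_prod_def intro: sum_nonneg)

lemma scalar_prod_self_eq_0: "(w :: real vec) \<in> carrier_vec n \<Longrightarrow> w \<bullet> w = 0 \<Longrightarrow> w = 0\<^sub>v n"
  by (auto simp: scalar_prod_def sum_nonneg_eq_0_iff intro!: eq_vecI)

lemma psd_cone_step:
  fixes A C X :: "real mat"
  assumes A: "A \<in> carrier_mat n n" and C: "C \<in> carrier_mat m n" and X: "X \<in> psd_cone n"
    and c: "0 \<le> c"
  shows "transpose_mat A * X * A + c \<cdot>\<^sub>m (transpose_mat C * C) \<in> psd_cone n" (is "?Y \<in> _")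
proof -
  have Xc: "X \<in> carrier_mat n n" and sym: "transpose_mat X = X"
    and nn: "\<And>v. v \<in> carrier_vec n \<Longrightarrow> 0 \<le> v \<bullet> (X *\<^sub>v v)"
    using X by (auto simp: psd_cone_def)
  have At: "transpose_mat A \<in> carrier_mat n n" and Ct: "transpose_mat C \<in> carrier_mat n m"
    using A C by auto
  have "transpose_mat (transpose_mat A * X * A) = transpose_mat A * X * A"
    using A At Xc sym transpose_mult[OF mult_carrier_mat[OF At Xc] A] transpose_mult[OF At Xc]
    by (simp add: assoc_mult_mat[OF At Xc A])
  moreover have "transpose_mat (c \<cdot>\<^sub>m (transpose_mat C * C)) = c \<cdot>\<^sub>m (transpose_mat C * C)"
    using transpose_mult[OF Ct C] C by (auto intro!: eq_matI comm_scalar_prod[of _ m])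
  ultimately have "transpose_mat ?Y = ?Y"
    using A C At Ct Xc by (subst transpose_add[of _ n n]) auto
  moreover have "0 \<le> v \<bullet> (?Y *\<^sub>v v)" if v: "v \<in> carrier_vec n" for v
    using nn[of "A *\<^sub>v v"] A v c scalar_prod_self_nonneg
    by (simp add: quadratic_form_step[OF A C Xc v])
  ultimately show ?thesis
    using A C Xc by (auto simp: psd_cone_def)
qed

text \<open>Two nonnegative terms with sum zero vanish separately, and \<open>0 < c\<close> can be
  cancelled from the second. This is the backward step of the kernel argument.\<close>

lemma quadratic_form_step_eq_0:
  fixes A C X :: "real mat"
  assumes A: "A \<in> carrier_mat n n" and C: "C \<in> carrier_mat m n" and X: "X \<in> psd_cone n"
    and c: "0 < c" and v: "v \<in> carrier_vec n"
    and zero: "v \<bullet> ((transpose_mat A * X * A + c \<cdot>\<^sub>m (transpose_mat C * C)) *\<^sub>v v) = 0"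
  shows "(A *\<^sub>v v) \<bullet> (X *\<^sub>v (A *\<^sub>v v)) = 0" and "C *\<^sub>v v = 0\<^sub>v m"
proof -
  have Xc: "X \<in> carrier_mat n n" and nn: "0 \<le> (A *\<^sub>v v) \<bullet> (X *\<^sub>v (A *\<^sub>v v))"
    using X A v by (auto simp: psd_cone_def)
  have "0 \<le> c * ((C *\<^sub>v v) \<bullet> (C *\<^sub>v v))"
    using c scalar_prod_self_nonneg[of "C *\<^sub>v v"] by simp
  with nn zero have "(A *\<^sub>v v) \<bullet> (X *\<^sub>v (A *\<^sub>v v)) = 0 \<and> c * ((C *\<^sub>v v) \<bullet> (C *\<^sub>v v)) = 0"
    unfolding quadratic_form_step[OF A C Xc v] by linarith
  then show "(A *\<^sub>v v) \<bullet> (X *\<^sub>v (A *\<^sub>v v)) = 0" and "C *\<^sub>v v = 0\<^sub>v m"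
    using c C v by (auto intro!: scalar_prod_self_eq_0)
qed

theorem lemma2:
  fixes n m :: nat and A C :: "real mat" and \<alpha> :: real
  assumes "A \<in> carrier_mat n n"
    and "C \<in> carrier_mat m n"
    and "\<alpha> > 0"
    and "schur_stable A"
    and "observable A C"
  shows "\<exists>T>0. \<forall>X :: nat \<Rightarrow> real mat.
           X 1 \<in> psd_cone n - {0\<^sub>m n n} \<and>
           (\<forall>k\<ge>1. X (k + 1) =
              transpose_mat A * X k * A + (\<alpha> * mat_trace (X k)) \<cdot>\<^sub>m (transpose_mat C * C))
           \<longrightarrow> (\<forall>k\<ge>T. pos_definite n (X k))"
proof (intro exI[of _ "n + 1"] conjI allI impI)
  show "0 < n + 1" by simp
next
  fix X :: "nat \<Rightarrow> real mat" and k
  assume X: "X 1 \<in> psd_cone n - {0\<^sub>m n n} \<and>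
      (\<forall>k\<ge>1. X (k + 1) =
        transpose_mat A * X k * A + (\<alpha> * mat_trace (X k)) \<cdot>\<^sub>m (transpose_mat C * C))"
    and k: "n + 1 \<le> k"
  note A = assms(1) and C = assms(2)
  \<comment> \<open>The shift lets inductions start at 0, and \<open>Y j\<close> is the state after
    exactly \<open>j\<close> updates; \<open>n\<close> updates lead to
    \<open>X (n + 1)\<close>.\<close>
  define Y where "Y j = X (Suc j)" for j
  have Y0: "Y 0 \<in> psd_cone n - {0\<^sub>m n n}"
    and step: "Y (Suc j) =
      transpose_mat A * Y j * A + (\<alpha> * mat_trace (Y j)) \<cdot>\<^sub>m (transpose_mat C * C)" for j
    using X by (auto simp: Y_def)
  \<comment> \<open>For \<open>n = 0\<close> the zero matrix is the only candidate for
    \<open>Y 0\<close>. The bound makes \<open>unit_vec n 0\<close> a genuine nonzero vector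
    below.\<close>
  have n: "n \<noteq> 0"
    using Y0 by (auto simp: psd_cone_def)
  have coeff: "0 < \<alpha> * mat_trace Z" if "Z \<in> psd_cone n - {0\<^sub>m n n}" for Z
    using that assms(3) psd_cone_trace_pos by auto
  have Y: "Y j \<in> psd_cone n - {0\<^sub>m n n}" for j
  proof (induction j)
    case (Suc j)
    have psd: "Y j \<in> psd_cone n" and c: "0 < \<alpha> * mat_trace (Y j)"
      using Suc coeff by auto
    \<comment> \<open>A zero successor has a form vanishing at every vector, so \<open>C\<close>
      would annihilate everything; observability would then make even a unit vector zero.\<close>
    have "Y (Suc j) \<noteq> 0\<^sub>m n n"
    proof
      assume "Y (Suc j) = 0\<^sub>m n n"
      moreover have "0\<^sub>m n n *\<^sub>v v = (0\<^sub>v n :: real vec)" if "v \<in> carrier_vec n" for v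
        using that by (intro eq_vecI) auto
      ultimately have "C *\<^sub>v v = 0\<^sub>v m" if "v \<in> carrier_vec n" for v
        using quadratic_form_step_eq_0(2)[OF A C psd c that] that by (simp add: step)
      then have "unit_vec n 0 = (0\<^sub>v n :: real vec)"
        using mult_mat_vec_carrier[OF pow_carrier_mat[OF A]]
        by (intro observable_injective[OF A C assms(5)]) auto
      then show False
        using n by simp
    qed
    then show ?case
      using psd_cone_step[OF A C psd, of "\<alpha> * mat_trace (Y j)"] c by (simp add: step)
  qed (rule Y0)
  \<comment> \<open>The vector is generalized in the induction: a zero of the form of
    \<open>Y (Suc j)\<close> at \<open>v\<close> gives \<open>C v = 0\<close>, the case
    \<open>i = 0\<close>, and a zero of the form of \<open>Y j\<close> at \<open>A v\<close>, which
    covers the higher powers.\<close>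
  have kernel: "C *\<^sub>v (A ^\<^sub>m i *\<^sub>v v) = 0\<^sub>v m"
    if "v \<in> carrier_vec n" "v \<bullet> (Y j *\<^sub>v v) = 0" "i < j" for i j v
    using that
  proof (induction j arbitrary: i v)
    case (Suc j)
    have psd: "Y j \<in> psd_cone n" and c: "0 < \<alpha> * mat_trace (Y j)"
      using Y coeff by auto
    note v = Suc.prems(1)
    note z = quadratic_form_step_eq_0[OF A C psd c v Suc.prems(2)[unfolded step]]
    show ?case
    proof (cases i)
      case 0
      then show ?thesis using z(2) A v by simp
    next
      case (Suc i')
      have "A ^\<^sub>m i *\<^sub>v v = A ^\<^sub>m i' *\<^sub>v (A *\<^sub>v v)"
        using A v Suc by (simp add: assoc_mult_mat_vec[of _ n n])
      then show ?thesis
        using Suc.IH[of "A *\<^sub>v v" i'] Suc.prems Suc z(1) A by simp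
    qed
  qed simp
  obtain j where j: "k = Suc j" "n \<le> j"
    using k by (cases k) auto
  have psd: "Y j \<in> psd_cone n" using Y by simp
  \<comment> \<open>Since \<open>n \<le> j\<close>, \<open>kernel\<close> covers every power
    \<open>i < n\<close> that observability asks for.\<close>
  have "v = 0\<^sub>v n" if "v \<in> carrier_vec n" "v \<bullet> (Y j *\<^sub>v v) = 0" for v
    using observable_injective[OF A C assms(5) that(1)] kernel[OF that] j(2) by simp
  then have "pos_definite n (Y j)"
    using psd unfolding psd_cone_def pos_definite_def by (force simp: order.strict_iff_order)
  then show "pos_definite n (X k)"
    by (simp add: Y_def j)
qed

end
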